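(* Let $F_+$ be the Thompson monoid, $S$ the facial monoid and $T$ the free abelian monoid on $\mathbf{N}$, with the right $S$-action on $T$ described in the context. There is a monoid embedding of $F_+$ into the right semi-direct product $S\ltimes T$. Moreover, that embedding is a lift for the canonical quotient $F_+\to S$, i.e. its composition with the projection $S\ltimes T\to S$ is the canonical quotient map $F_+\to S$, $g_i\mapsto s_i$.
   Context: $\mathbf{N}=\{1,2,\ldots\}$. The Thompson monoid is given by the monoid presentation $F_+=\langle g_i\ (i\in\mathbf{N}) : g_jg_i=g_ig_{j+1}\ \forall\,1\leq i<j\rangle$. The facial monoid is given by the monoid presentation $S=\langle s_i\ (i\in\mathbf{N}) : s_js_i=s_is_{j+1}\ \forall\,1\leq i\leq j\rangle$; it is a quotient of $F_+$ via $g_i\mapsto s_i$. $T$ is the free abelian monoid on the set $\mathbf{N}$; its elements are written $t=(t_n)_{n\in\mathbf{N}}$ with $t_n$ non-negative integers, all but finitely many zero, and the operation is addition. (Alternatively, $T$ may be taken to be the free abelian group $\mathbf{Z}[\mathbf{N}]$.) The right action of $S$ on $T$ by endomorphisms, denoted $t^s$, is determined by $$(t^{s_i})_n=\begin{cases} t_n & \text{if } n\leq i,\\ 0 & \text{if } n=i+1,\\ t_{n-1} & \text{if } n\geq i+2.\end{cases}$$ The right semi-direct product $S\ltimes T$ is the product set $S\times T$ with the associative multiplication $(s,t)(s',t')=(ss',\,t^{s'}\,t')$ (where the operation of $T$, here addition, is written multiplicatively). *)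

theory Defs
  imports "HOL-Algebra.Group" "HOL-Library.Poly_Mapping"
begin

section \<open>Monoid presentations\<close>

text \<open>A relation \<open>u = v\<close> of a presentation is encoded as the pair \<open>(u, v)\<close> of words.\<close>

inductive_set presentation_cong :: "'a set \<Rightarrow> ('a list \<times> 'a list) set \<Rightarrow> ('a list \<times> 'a list) set"
  for X :: "'a set" and R :: "('a list \<times> 'a list) set"
where
  base: "(u, v) \<in> R \<Longrightarrow> u \<in> lists X \<Longrightarrow> v \<in> lists X \<Longrightarrow> (u, v) \<in> presentation_cong X R"
| refl: "u \<in> lists X \<Longrightarrow> (u, u) \<in> presentation_cong X R"
| sym: "(u, v) \<in> presentation_cong X R \<Longrightarrow> (v, u) \<in> presentation_cong X R"
| trans: "(u, v) \<in> presentation_cong X R \<Longrightarrow> (v, w) \<in> presentation_cong X R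
    \<Longrightarrow> (u, w) \<in> presentation_cong X R"
| append: "(u, v) \<in> presentation_cong X R \<Longrightarrow> (u', v') \<in> presentation_cong X R
    \<Longrightarrow> (u @ u', v @ v') \<in> presentation_cong X R"

definition presented_monoid :: "'a set \<Rightarrow> ('a list \<times> 'a list) set \<Rightarrow> 'a list set monoid" where
  "presented_monoid X R =
    \<lparr>carrier = lists X // presentation_cong X R,
     mult = (\<lambda>A B. \<Union>u\<in>A. \<Union>v\<in>B. presentation_cong X R `` {u @ v}),
     one = presentation_cong X R `` {[]}\<rparr>"

lemma presentation_cong_lists:
  "(u, v) \<in> presentation_cong X R \<Longrightarrow> u \<in> lists X \<and> v \<in> lists X"
  by (induction rule: presentation_cong.induct) auto

lemma equiv_presentation_cong: "equiv (lists X) (presentation_cong X R)"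
proof (rule equivI)
  show "presentation_cong X R \<subseteq> lists X \<times> lists X"
    using presentation_cong_lists by (metis mem_Sigma_iff subrelI)
  show "refl_on (lists X) (presentation_cong X R)"
    by (auto intro: refl_onI presentation_cong.refl)
  show "sym (presentation_cong X R)"
    by (auto intro: symI presentation_cong.sym)
  show "trans (presentation_cong X R)"
    by (auto intro: transI presentation_cong.trans)
qed

lemma presentation_cong_class_eq:
  assumes "u \<in> lists X" "v \<in> lists X"
  shows "presentation_cong X R `` {u} = presentation_cong X R `` {v}
    \<longleftrightarrow> (u, v) \<in> presentation_cong X R"
  using eq_equiv_class_iff[OF equiv_presentation_cong assms] .

lemma presented_monoid_mult:
  assumes "u \<in> lists X" "v \<in> lists X"
  shows "presentation_cong X R `` {u} \<otimes>\<^bsub>presented_monoid X R\<^esub> presentation_cong X R `` {v}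
    = presentation_cong X R `` {u @ v}"
proof -
  have eq: "presentation_cong X R `` {u' @ v'} = presentation_cong X R `` {u @ v}"
    if "(u, u') \<in> presentation_cong X R" "(v, v') \<in> presentation_cong X R" for u' v'
    using equiv_class_eq[OF equiv_presentation_cong presentation_cong.append[OF that]] by simp
  have refl: "(u, u) \<in> presentation_cong X R" "(v, v) \<in> presentation_cong X R"
    using assms by (auto intro: presentation_cong.refl)
  have "(\<Union>u'\<in>presentation_cong X R `` {u}. \<Union>v'\<in>presentation_cong X R `` {v}.
      presentation_cong X R `` {u' @ v'}) = presentation_cong X R `` {u @ v}" (is "?L = ?Q")
  proof
    show "?L \<subseteq> ?Q" using eq by blast
    show "?Q \<subseteq> ?L" using refl by blast
  qed
  then show ?thesis
    by (simp add: presented_monoid_def)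
qed

lemma presented_monoid_cases:
  assumes "A \<in> carrier (presented_monoid X R)"
  obtains w where "w \<in> lists X" "A = presentation_cong X R `` {w}"
  using assms quotientE[of A "lists X" "presentation_cong X R"]
  by (metis partial_object.select_convs(1) presented_monoid_def)

lemma presented_monoid_class_in_carrier:
  "w \<in> lists X \<Longrightarrow> presentation_cong X R `` {w} \<in> carrier (presented_monoid X R)"
  by (simp add: presented_monoid_def quotientI)

lemma presented_monoid_one: "\<one>\<^bsub>presented_monoid X R\<^esub> = presentation_cong X R `` {[]}"
  by (simp add: presented_monoid_def)

lemma monoid_presented_monoid: "monoid (presented_monoid X R)" (is "monoid ?M")
proof (rule monoidI)
  note [simp] = presented_monoid_mult presented_monoid_one presented_monoid_class_in_carrier
  show "A \<otimes>\<^bsub>?M\<^esub> B \<in> carrier ?M" if "A \<in> carrier ?M" "B \<in> carrier ?M" for A B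
    using that(1) by (rule presented_monoid_cases, use that(2) in \<open>rule presented_monoid_cases\<close>) simp
  show "A \<otimes>\<^bsub>?M\<^esub> B \<otimes>\<^bsub>?M\<^esub> C = A \<otimes>\<^bsub>?M\<^esub> (B \<otimes>\<^bsub>?M\<^esub> C)"
    if "A \<in> carrier ?M" "B \<in> carrier ?M" "C \<in> carrier ?M" for A B C
  proof -
    from that obtain u v w where "u \<in> lists X" "A = presentation_cong X R `` {u}"
      "v \<in> lists X" "B = presentation_cong X R `` {v}"
      "w \<in> lists X" "C = presentation_cong X R `` {w}"
      by (metis presented_monoid_cases)
    then show ?thesis by simp
  qed
  show "\<one>\<^bsub>?M\<^esub> \<in> carrier ?M" by simp
  show "\<one>\<^bsub>?M\<^esub> \<otimes>\<^bsub>?M\<^esub> A = A" if "A \<in> carrier ?M" for A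
    using that by (rule presented_monoid_cases) simp
  show "A \<otimes>\<^bsub>?M\<^esub> \<one>\<^bsub>?M\<^esub> = A" if "A \<in> carrier ?M" for A
    using that by (rule presented_monoid_cases) simp
qed


section \<open>The Thompson monoid and the facial monoid\<close>

text \<open>Generators are indexed by \<open>{1..}\<close>, the positive natural numbers.\<close>

definition thompson_rels :: "(nat list \<times> nat list) set" where
  "thompson_rels = {([j, i], [i, j + 1]) |i j. 1 \<le> i \<and> i < j}"

definition facial_rels :: "(nat list \<times> nat list) set" where
  "facial_rels = {([j, i], [i, j + 1]) |i j. 1 \<le> i \<and> i \<le> j}"

abbreviation thompson_cong :: "(nat list \<times> nat list) set" where
  "thompson_cong \<equiv> presentation_cong {1..} thompson_rels"

abbreviation facial_cong :: "(nat list \<times> nat list) set" where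
  "facial_cong \<equiv> presentation_cong {1..} facial_rels"

definition thompson_monoid :: "nat list set monoid" where
  "thompson_monoid = presented_monoid {1..} thompson_rels"

definition facial_monoid :: "nat list set monoid" where
  "facial_monoid = presented_monoid {1..} facial_rels"

definition thompson_gen :: "nat \<Rightarrow> nat list set" where
  "thompson_gen i = thompson_cong `` {[i]}"

definition facial_gen :: "nat \<Rightarrow> nat list set" where
  "facial_gen i = facial_cong `` {[i]}"

text \<open>As \<open>thompson_cong \<subseteq> facial_cong\<close>, the set of all words that are facially congruent to some
  word in a Thompson class is a single facial class.\<close>

definition canonical_quotient :: "nat list set \<Rightarrow> nat list set" where
  "canonical_quotient A = facial_cong `` A"

lemma thompson_cong_subset_facial_cong: "thompson_cong \<subseteq> facial_cong"
proof (rule subrelI)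
  show "(u, v) \<in> facial_cong" if "(u, v) \<in> thompson_cong" for u v
    using that
  proof (induction rule: presentation_cong.induct)
    case (base u v)
    then have "(u, v) \<in> facial_rels"
      by (fastforce simp: thompson_rels_def facial_rels_def)
    with base show ?case by (blast intro: presentation_cong.base)
  qed (blast intro: presentation_cong.intros)+
qed

lemma canonical_quotient_class:
  assumes "w \<in> lists {1..}"
  shows "canonical_quotient (thompson_cong `` {w}) = facial_cong `` {w}"
  using assms thompson_cong_subset_facial_cong
  unfolding canonical_quotient_def
  by (blast intro: presentation_cong.intros)

lemma canonical_quotient_gen: "1 \<le> i \<Longrightarrow> canonical_quotient (thompson_gen i) = facial_gen i"
  by (simp add: thompson_gen_def facial_gen_def canonical_quotient_class del: One_nat_def)

lemma canonical_quotient_hom: "canonical_quotient \<in> hom thompson_monoid facial_monoid"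
  unfolding thompson_monoid_def facial_monoid_def
  by (rule homI; elim presented_monoid_cases)
    (simp_all add: presented_monoid_mult canonical_quotient_class presented_monoid_class_in_carrier
      del: One_nat_def)

lemma canonical_quotient_one: "canonical_quotient \<one>\<^bsub>thompson_monoid\<^esub> = \<one>\<^bsub>facial_monoid\<^esub>"
  by (simp add: thompson_monoid_def facial_monoid_def presented_monoid_one canonical_quotient_class
      del: One_nat_def)

lemma canonical_quotient_surj:
  "canonical_quotient ` carrier thompson_monoid = carrier facial_monoid"
proof
  show "canonical_quotient ` carrier thompson_monoid \<subseteq> carrier facial_monoid"
    using canonical_quotient_hom by (auto simp: hom_def)
  show "carrier facial_monoid \<subseteq> canonical_quotient ` carrier thompson_monoid"
    unfolding thompson_monoid_def facial_monoid_def
    by (metis (no_types, lifting) canonical_quotient_class image_eqI presented_monoid_cases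
        presented_monoid_class_in_carrier subsetI)
qed


section \<open>The free abelian monoid and the action of the facial monoid\<close>

definition free_abelian_monoid :: "'a set \<Rightarrow> ('a \<Rightarrow>\<^sub>0 nat) monoid" where
  "free_abelian_monoid X = \<lparr>carrier = {t. Poly_Mapping.keys t \<subseteq> X}, mult = (+), one = 0\<rparr>"

lift_definition shift :: "nat \<Rightarrow> (nat \<Rightarrow>\<^sub>0 nat) \<Rightarrow> (nat \<Rightarrow>\<^sub>0 nat)" is
  "\<lambda>i t n. if n \<le> i then t n else if n = i + 1 then 0 else t (n - 1)"
proof -
  fix i :: nat and t :: "nat \<Rightarrow> nat"
  assume "finite {n. t n \<noteq> 0}"
  then have "finite ({n. t n \<noteq> 0} \<union> Suc ` {n. t n \<noteq> 0})" by simp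
  moreover have "{n. (if n \<le> i then t n else if n = i + 1 then 0 else t (n - 1)) \<noteq> 0}
      \<subseteq> {n. t n \<noteq> 0} \<union> Suc ` {n. t n \<noteq> 0}"
  proof
    fix n
    assume "n \<in> {n. (if n \<le> i then t n else if n = i + 1 then 0 else t (n - 1)) \<noteq> 0}"
    then show "n \<in> {n. t n \<noteq> 0} \<union> Suc ` {n. t n \<noteq> 0}"
      by (cases n) (auto split: if_splits)
  qed
  ultimately show
    "finite {n. (if n \<le> i then t n else if n = i + 1 then 0 else t (n - 1)) \<noteq> 0}"
    by (rule rev_finite_subset)
qed

text \<open>The right action \<open>facial_action t s\<close>, i.e. \<open>t\<^sup>s\<close>. Since it is a right action, the letters of a
  word act from left to right, which is how \<open>fold\<close> processes a list; \<open>facial_action_class\<close> below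
  shows that the result does not depend on the word chosen.\<close>

definition facial_action :: "(nat \<Rightarrow>\<^sub>0 nat) \<Rightarrow> nat list set \<Rightarrow> (nat \<Rightarrow>\<^sub>0 nat)" where
  "facial_action t s = the_elem ((\<lambda>w. fold shift w t) ` s)"

definition right_semidirect_product ::
    "('a, 'm) monoid_scheme \<Rightarrow> ('b, 'n) monoid_scheme \<Rightarrow> ('b \<Rightarrow> 'a \<Rightarrow> 'b) \<Rightarrow> ('a \<times> 'b) monoid" where
  "right_semidirect_product S T act =
    \<lparr>carrier = carrier S \<times> carrier T,
     mult = (\<lambda>(s, t) (s', t'). (s \<otimes>\<^bsub>S\<^esub> s', act t s' \<otimes>\<^bsub>T\<^esub> t')),
     one = (\<one>\<^bsub>S\<^esub>, \<one>\<^bsub>T\<^esub>)\<rparr>"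

definition facial_semidirect_product :: "(nat list set \<times> (nat \<Rightarrow>\<^sub>0 nat)) monoid" where
  "facial_semidirect_product =
    right_semidirect_product facial_monoid (free_abelian_monoid {1..}) facial_action"

lemma shift_shift:
  assumes "i \<le> j"
  shows "shift i (shift j t) = shift (j + 1) (shift i t)"
  by (rule poly_mapping_eqI) (use assms in \<open>auto simp: shift.rep_eq\<close>)

lemma fold_shift_cong: "(u, v) \<in> facial_cong \<Longrightarrow> fold shift u t = fold shift v t"
proof (induction arbitrary: t rule: presentation_cong.induct)
  case (base u v)
  then obtain i j where "u = [j, i]" "v = [i, j + 1]" "i \<le> j"
    unfolding facial_rels_def by blast
  then show ?case by (simp add: shift_shift[OF \<open>i \<le> j\<close>])
next
  case (append u v u' v')
  show ?case by (simp only: fold_append comp_apply append.IH)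
next
  case (sym u v)
  show ?case by (rule sym.IH[symmetric])
next
  case (trans u v w)
  show ?case by (simp only: trans.IH)
qed (rule HOL.refl)

lemma facial_action_class:
  assumes "w \<in> lists {1..}"
  shows "facial_action t (facial_cong `` {w}) = fold shift w t"
proof -
  have "(\<lambda>v. fold shift v t) ` (facial_cong `` {w}) = {fold shift w t}"
  proof
    show "(\<lambda>v. fold shift v t) ` (facial_cong `` {w}) \<subseteq> {fold shift w t}"
      using fold_shift_cong by (metis Image_singleton_iff image_subsetI singletonI)
    show "{fold shift w t} \<subseteq> (\<lambda>v. fold shift v t) ` (facial_cong `` {w})"
      using presentation_cong.refl[OF assms] by blast
  qed
  then show ?thesis by (simp add: facial_action_def)
qed

lemma facial_action_gen:
  assumes "1 \<le> i"
  shows "Poly_Mapping.lookup (facial_action t (facial_gen i)) n =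
    (if n \<le> i then Poly_Mapping.lookup t n
     else if n = i + 1 then 0 else Poly_Mapping.lookup t (n - 1))"
  using assms by (simp add: facial_gen_def facial_action_class shift.rep_eq del: One_nat_def)

lemma facial_action_one: "facial_action t \<one>\<^bsub>facial_monoid\<^esub> = t"
  by (simp add: facial_monoid_def presented_monoid_one facial_action_class
      del: One_nat_def)

lemma facial_action_mult:
  assumes "s \<in> carrier facial_monoid" "s' \<in> carrier facial_monoid"
  shows "facial_action t (s \<otimes>\<^bsub>facial_monoid\<^esub> s') = facial_action (facial_action t s) s'"
  using assms unfolding facial_monoid_def
  by (elim presented_monoid_cases) (simp add: presented_monoid_mult facial_action_class del: One_nat_def)

lemma shift_add: "shift i (t + t') = shift i t + shift i t'"
  by (rule poly_mapping_eqI) (simp add: shift.rep_eq lookup_add)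

lemma shift_zero: "shift i 0 = 0"
  by (rule poly_mapping_eqI) (simp add: shift.rep_eq)

lemma keys_shift:
  assumes "Poly_Mapping.keys t \<subseteq> {1..}"
  shows "Poly_Mapping.keys (shift i t) \<subseteq> {1..}"
proof -
  have "Poly_Mapping.lookup t 0 = 0"
    using assms by (metis atLeast_iff in_keys_iff not_one_le_zero subsetD)
  then have "Poly_Mapping.lookup (shift i t) 0 = 0"
    by (simp add: shift.rep_eq)
  then show ?thesis
    by (metis One_nat_def Suc_leI atLeast_iff bot_nat_0.not_eq_extremum in_keys_iff subsetI)
qed

lemma facial_action_closed:
  assumes "s \<in> carrier facial_monoid" "t \<in> carrier (free_abelian_monoid {1..})"
  shows "facial_action t s \<in> carrier (free_abelian_monoid {1..})"
proof -
  have "Poly_Mapping.keys (fold shift w t) \<subseteq> {1..}" if "Poly_Mapping.keys t \<subseteq> {1..}" for w t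
    using that by (induction w arbitrary: t) (simp_all add: keys_shift del: One_nat_def)
  then show ?thesis
    using assms unfolding facial_monoid_def
    by (elim presented_monoid_cases) (simp add: facial_action_class free_abelian_monoid_def del: One_nat_def)
qed

lemma facial_action_add:
  assumes "s \<in> carrier facial_monoid"
  shows "facial_action (t + t') s = facial_action t s + facial_action t' s"
proof -
  have "fold shift w (t + t') = fold shift w t + fold shift w t'" for w t t'
    by (induction w arbitrary: t t') (auto simp: shift_add)
  then show ?thesis
    using assms unfolding facial_monoid_def
    by (elim presented_monoid_cases) (simp add: facial_action_class del: One_nat_def)
qed

lemma facial_action_zero:
  assumes "s \<in> carrier facial_monoid"
  shows "facial_action 0 s = 0"
proof -
  have "fold shift w 0 = 0" for w
    by (induction w) (auto simp: shift_zero)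
  then show ?thesis
    using assms unfolding facial_monoid_def
    by (elim presented_monoid_cases) (simp add: facial_action_class del: One_nat_def)
qed

lemma comm_monoid_free_abelian_monoid: "comm_monoid (free_abelian_monoid X)"
proof (rule comm_monoidI)
  show "t \<otimes>\<^bsub>free_abelian_monoid X\<^esub> t' \<in> carrier (free_abelian_monoid X)"
    if "t \<in> carrier (free_abelian_monoid X)" "t' \<in> carrier (free_abelian_monoid X)" for t t'
    using that Poly_Mapping.keys_add[of t t'] by (auto simp: free_abelian_monoid_def)
qed (auto simp: free_abelian_monoid_def algebra_simps)

lemma monoid_facial_semidirect_product: "monoid facial_semidirect_product"
proof -
  interpret S: monoid facial_monoid
    unfolding facial_monoid_def by (rule monoid_presented_monoid)
  interpret T: comm_monoid "free_abelian_monoid {1..} :: (nat \<Rightarrow>\<^sub>0 nat) monoid"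
    by (rule comm_monoid_free_abelian_monoid)
  have add: "facial_action (t \<otimes>\<^bsub>free_abelian_monoid {1..}\<^esub> t') s
      = facial_action t s \<otimes>\<^bsub>free_abelian_monoid {1..}\<^esub> facial_action t' s"
    and zero: "facial_action \<one>\<^bsub>free_abelian_monoid {1..}\<^esub> s = \<one>\<^bsub>free_abelian_monoid {1..}\<^esub>"
    if "s \<in> carrier facial_monoid" for s and t t' :: "nat \<Rightarrow>\<^sub>0 nat"
    using that by (simp_all add: free_abelian_monoid_def facial_action_add facial_action_zero)
  show ?thesis
    unfolding facial_semidirect_product_def right_semidirect_product_def
    by (rule monoidI)
      (auto simp: facial_action_closed facial_action_mult facial_action_one S.m_assoc T.m_assoc
        add zero simp del: One_nat_def)
qed

end

(* The embedding sends g_i to (s_i, e_i), with e_i the i-th basis vector of T. Every element of F_+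
   is represented by a nondecreasing word, and e_i is fixed by s_j whenever i <= j; hence the
   T-component of such a word is the sum of the e_i over its letters, which determines the word.
   So the T-component alone is already injective. *)

theory Submission
  imports Defs "HOL-Library.Multiset"
begin

text \<open>The T-component of the product of the pairs (s_i, e_i) over the letters of a word: each
  e_i is acted on by the letters to its right.\<close>

fun translation :: "nat list \<Rightarrow> (nat \<Rightarrow>\<^sub>0 nat)" where
  "translation [] = 0"
| "translation (i # w) = fold shift w (Poly_Mapping.single i 1) + translation w"

lemma fold_shift_add: "fold shift w (t + t') = fold shift w t + fold shift w t'"
  by (induction w arbitrary: t t') (simp_all add: shift_add)

lemma fold_shift_zero: "fold shift w 0 = 0"
  by (induction w) (simp_all add: shift_zero)

text \<open>This is the T-part of the multiplication rule in the semi-direct product; it makes the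
  embedding multiplicative.\<close>

lemma translation_append: "translation (u @ v) = fold shift v (translation u) + translation v"
  by (induction u) (simp_all add: fold_shift_add fold_shift_zero add.assoc)

lemma shift_single:
  "shift i (Poly_Mapping.single j c) = Poly_Mapping.single (if j \<le> i then j else j + 1) c"
  by (rule poly_mapping_eqI) (auto simp: shift.rep_eq lookup_single when_def)

lemma translation_cong: "(u, v) \<in> thompson_cong \<Longrightarrow> translation u = translation v"
proof (induction rule: presentation_cong.induct)
  case (base u v)
  then obtain i j where "u = [j, i]" "v = [i, j + 1]" "i < j"
    unfolding thompson_rels_def by blast
  \<comment> \<open>Both words yield e_i + e_{j+1}. Strictness of i < j matters: for i = j the left
    word would yield 2 e_i, so \<open>translation\<close> does not descend to the facial
    monoid.\<close>
  then show ?case by (simp add: shift_single add.commute)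
next
  case (append u v u' v')
  \<comment> \<open>The right factors also act on the translation of the left ones, and this action
    depends only on facial classes.\<close>
  then have "(u', v') \<in> facial_cong"
    using thompson_cong_subset_facial_cong by blast
  then show ?case
    by (simp add: translation_append fold_shift_cong append.IH)
qed simp_all

lemma keys_translation: "w \<in> lists {1..} \<Longrightarrow> Poly_Mapping.keys (translation w) \<subseteq> {1..}"
proof (induction w)
  case (Cons i w)
  have "Poly_Mapping.keys (fold shift v t) \<subseteq> {1..}" if "Poly_Mapping.keys t \<subseteq> {1..}" for v t
    using that by (induction v arbitrary: t) (simp_all add: keys_shift del: One_nat_def)
  from this[of "Poly_Mapping.single i 1" w] Cons show ?case
    using Poly_Mapping.keys_add[of "fold shift w (Poly_Mapping.single i 1)" "translation w"] by auto
qed simp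

lemma fold_shift_single:
  "\<forall>j \<in> set w. i \<le> j \<Longrightarrow> fold shift w (Poly_Mapping.single i c) = Poly_Mapping.single i c"
  by (induction w) (simp_all add: shift_single)

lemma lookup_translation_sorted:
  "sorted w \<Longrightarrow> Poly_Mapping.lookup (translation w) n = count (mset w) n"
  by (induction w) (simp_all add: fold_shift_single lookup_add lookup_single when_def)

lemma translation_inj_sorted:
  assumes "sorted u" "sorted v" "translation u = translation v"
  shows "u = v"
proof -
  have "mset u = mset v"
    by (rule multiset_eqI) (metis assms lookup_translation_sorted)
  then show ?thesis
    using assms(1,2) by (metis properties_for_sort)
qed

lemma thompson_cong_Cons:
  assumes "(u, v) \<in> thompson_cong" "1 \<le> i"
  shows "(i # u, i # v) \<in> thompson_cong"
  using presentation_cong.append[OF presentation_cong.refl[of "[i]"] assms(1)] assms(2) by simp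

text \<open>One step of insertion sort: j travels right past the smaller letters, growing by one at
  each. The clause on lower bounds m strengthens the induction, so that a smaller head can be put
  back in front.\<close>

lemma thompson_cong_insert:
  assumes "sorted w" "w \<in> lists {1..}" "1 \<le> j"
  shows "\<exists>v. (j # w, v) \<in> thompson_cong \<and> sorted v
    \<and> (\<forall>m \<le> j. (\<forall>x \<in> set w. m \<le> x) \<longrightarrow> (\<forall>x \<in> set v. m \<le> x))"
  using assms
proof (induction w arbitrary: j)
  case Nil
  then show ?case
    by (intro exI[of _ "[j]"]) (auto intro: presentation_cong.refl)
next
  case (Cons i w)
  show ?case
  proof (cases "j \<le> i")
    case True
    have "(j # i # w, j # i # w) \<in> thompson_cong"
      using Cons.prems by (intro presentation_cong.refl) simp
    with True Cons.prems show ?thesis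
      by (intro exI[of _ "j # i # w"]) auto
  next
    case False
    \<comment> \<open>The relation turns j i into i (j + 1), so what remains to be inserted into the
      tail is j + 1.\<close>
    obtain v where v: "((j + 1) # w, v) \<in> thompson_cong" "sorted v"
      "\<And>m. m \<le> j + 1 \<Longrightarrow> \<forall>x \<in> set w. m \<le> x \<Longrightarrow> \<forall>x \<in> set v. m \<le> x"
      using Cons.IH[of "j + 1"] Cons.prems by auto
    have "([j, i], [i, j + 1]) \<in> thompson_cong"
      using False Cons.prems by (intro presentation_cong.base) (auto simp: thompson_rels_def)
    moreover have "(w, w) \<in> thompson_cong"
      using Cons.prems by (intro presentation_cong.refl) simp
    ultimately have "(j # i # w, i # (j + 1) # w) \<in> thompson_cong"
      using presentation_cong.append by fastforce
    moreover have "(i # (j + 1) # w, i # v) \<in> thompson_cong"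
      using v(1) Cons.prems by (intro thompson_cong_Cons) auto
    ultimately have "(j # i # w, i # v) \<in> thompson_cong"
      by (rule presentation_cong.trans)
    \<comment> \<open>Here i bounds the letters of \<open>w\<close> from below and i < j, so it is
      an admissible bound m for \<open>v\<close>.\<close>
    moreover have "sorted (i # v)"
      using v(2) v(3)[of i] False Cons.prems by auto
    moreover have "\<forall>x \<in> set (i # v). m \<le> x" if "m \<le> j" "\<forall>x \<in> set (i # w). m \<le> x" for m
      using v(3)[of m] that by auto
    ultimately show ?thesis by blast
  qed
qed

lemma thompson_cong_sorted:
  assumes "w \<in> lists {1..}"
  obtains v where "(w, v) \<in> thompson_cong" "sorted v"
proof -
  have "\<exists>v. (w, v) \<in> thompson_cong \<and> sorted v"
    using assms
  proof (induction rule: lists.induct)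
    case Nil
    show ?case by (auto intro: presentation_cong.refl)
  next
    case (Cons i w)
    then obtain v where v: "(w, v) \<in> thompson_cong" "sorted v" by blast
    have i: "1 \<le> i" using Cons.hyps by simp
    have "v \<in> lists {1..}" using v(1) presentation_cong_lists by blast
    then obtain v' where "(i # v, v') \<in> thompson_cong" "sorted v'"
      using thompson_cong_insert[OF v(2)] i by blast
    moreover have "(i # w, i # v) \<in> thompson_cong"
      using v(1) i by (rule thompson_cong_Cons)
    ultimately show ?case by (blast intro: presentation_cong.trans)
  qed
  then show ?thesis using that by blast
qed

text \<open>Sorted representatives with equal translations coincide as words, so
  \<open>translation\<close> is a complete invariant of Thompson classes.\<close>

lemma thompson_cong_iff_translation:
  assumes "u \<in> lists {1..}" "v \<in> lists {1..}"
  shows "(u, v) \<in> thompson_cong \<longleftrightarrow> translation u = translation v"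
proof
  assume eq: "translation u = translation v"
  obtain u' v' where *: "(u, u') \<in> thompson_cong" "sorted u'" "(v, v') \<in> thompson_cong" "sorted v'"
    using assms thompson_cong_sorted by metis
  then have "u' = v'"
    using eq by (intro translation_inj_sorted) (simp_all add: translation_cong[symmetric])
  with * show "(u, v) \<in> thompson_cong"
    by (blast intro: presentation_cong.sym presentation_cong.trans)
qed (rule translation_cong)

text \<open>\<open>the_elem\<close> extracts the single value that \<open>translation\<close> takes
  on a class. With the canonical quotient as first component, the lifting property holds by
  definition.\<close>

definition thompson_embedding :: "nat list set \<Rightarrow> nat list set \<times> (nat \<Rightarrow>\<^sub>0 nat)" where
  "thompson_embedding A = (canonical_quotient A, the_elem (translation ` A))"

lemma thompson_embedding_class:
  assumes "w \<in> lists {1..}"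
  shows "thompson_embedding (thompson_cong `` {w}) = (facial_cong `` {w}, translation w)"
proof -
  have "translation ` (thompson_cong `` {w}) = {translation w}"
    using presentation_cong.refl[OF assms] translation_cong by force
  then show ?thesis
    using assms by (simp add: thompson_embedding_def canonical_quotient_class del: One_nat_def)
qed

lemma thompson_embedding_hom: "thompson_embedding \<in> hom thompson_monoid facial_semidirect_product"
proof (rule homI; unfold thompson_monoid_def; elim presented_monoid_cases)
  fix A u assume "u \<in> lists {1..}" "A = thompson_cong `` {u}"
  then show "thompson_embedding A \<in> carrier facial_semidirect_product"
    by (simp add: thompson_embedding_class facial_semidirect_product_def keys_translation
        right_semidirect_product_def facial_monoid_def presented_monoid_class_in_carrier
        free_abelian_monoid_def del: One_nat_def)
next
  fix A B u v
  assume "u \<in> lists {1..}" "A = thompson_cong `` {u}" "v \<in> lists {1..}" "B = thompson_cong `` {v}"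
  then show "thompson_embedding (A \<otimes>\<^bsub>presented_monoid {1..} thompson_rels\<^esub> B)
      = thompson_embedding A \<otimes>\<^bsub>facial_semidirect_product\<^esub> thompson_embedding B"
    by (simp add: presented_monoid_mult thompson_embedding_class facial_semidirect_product_def
        right_semidirect_product_def facial_monoid_def free_abelian_monoid_def facial_action_class
        translation_append del: One_nat_def)
qed

lemma inj_on_thompson_embedding: "inj_on thompson_embedding (carrier thompson_monoid)"
proof (rule inj_onI; unfold thompson_monoid_def; elim presented_monoid_cases)
  fix A B u v
  assume "thompson_embedding A = thompson_embedding B"
    and "u \<in> lists {1..}" "A = thompson_cong `` {u}" "v \<in> lists {1..}" "B = thompson_cong `` {v}"
  \<comment> \<open>Equality of the second components alone forces the words to be
    congruent.\<close>
  then show "A = B"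
    by (simp add: thompson_embedding_class presentation_cong_class_eq thompson_cong_iff_translation
        del: One_nat_def)
qed

lemma thompson_embedding_one:
  "thompson_embedding \<one>\<^bsub>thompson_monoid\<^esub> = \<one>\<^bsub>facial_semidirect_product\<^esub>"
  by (simp add: thompson_monoid_def presented_monoid_one thompson_embedding_class
      facial_semidirect_product_def right_semidirect_product_def facial_monoid_def
      free_abelian_monoid_def del: One_nat_def)

theorem proposition5p5:
  shows "\<exists>\<phi>. \<phi> \<in> mon thompson_monoid facial_semidirect_product
    \<and> \<phi> \<one>\<^bsub>thompson_monoid\<^esub> = \<one>\<^bsub>facial_semidirect_product\<^esub>
    \<and> (\<forall>x \<in> carrier thompson_monoid. fst (\<phi> x) = canonical_quotient x)"
  \<comment> \<open>Membership in \<open>mon\<close> means an injective map preserving products;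
    preservation of the unit is supplied separately.\<close>
  using thompson_embedding_hom inj_on_thompson_embedding thompson_embedding_one
  by (intro exI[of _ thompson_embedding]) (simp add: mon_def thompson_embedding_def)

end
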